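(* Let $n,k$ be positive integers. Suppose that to every graph $G$ on the vertex set $\{1,\dots,n\}$ there is assigned a $k$-tuple $\mathbf A_G=(A_{G,1},\dots,A_{G,k})$ of real $n\times n$ matrices. Then there exists $\mathbf s_0\in\mathbb Z^k$ (not depending on the pair of graphs below) such that for every pair of graphs $G,H$ on $n$ vertices, $\phi_{\mathbf A_G}(\mathbf s;t)=\phi_{\mathbf A_H}(\mathbf s;t)$ holds identically (as polynomials in $\mathbf s$ and $t$) if and only if $\phi_{\mathbf A_G}(\mathbf s_0;t)=\phi_{\mathbf A_H}(\mathbf s_0;t)$; that is, $W_{\mathbf A_G}(\mathbf s_0)$ and $W_{\mathbf A_H}(\mathbf s_0)$ have the same spectrum if and only if $W_{\mathbf A_G}(\mathbf s)$ and $W_{\mathbf A_H}(\mathbf s)$ have the same spectrum for all $\mathbf s$.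
   Context: For a tuple $\mathbf A=(A_1,\dots,A_k)$ of $n\times n$ matrices and variables $\mathbf s=(s_1,\dots,s_k)$, $W_{\mathbf A}(\mathbf s)=\sum_{i=1}^ks_iA_i$ and $\phi_{\mathbf A}(\mathbf s;t)=\det(tI-W_{\mathbf A}(\mathbf s))$. *)

theory Defs
  imports
    "Jordan_Normal_Form.Char_Poly"
    "HOL-Library.Poly_Mapping"
    "HOL-Computational_Algebra.Polynomial"
    Complex_Main
begin

text \<open>A finite simple graph is a pair of a vertex set and a set of two-element sets of vertices.\<close>

type_synonym graph = "nat set \<times> nat set set"

definition graphs :: "nat \<Rightarrow> graph set" where
  "graphs n = {(V, E). V = {1..n} \<and> (\<forall>e\<in>E. e \<subseteq> V \<and> card e = 2)}"

text \<open>
  A \<open>k\<close>-tuple of matrices is a list of length \<open>k\<close>, and the parameters \<open>s\<close> form a vector of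
  dimension \<open>k\<close>; both are indexed from \<open>0\<close>. The coefficient ring is left open: it is \<open>real\<close> for
  the specializations of \<open>s\<close> and a polynomial ring for indeterminate \<open>s\<close>.
\<close>

definition W :: "nat \<Rightarrow> 'a::comm_ring_1 mat list \<Rightarrow> 'a vec \<Rightarrow> 'a mat" where
  "W n As s = mat n n (\<lambda>(p, q). \<Sum>i<length As. s $ i * (As ! i) $$ (p, q))"

text \<open>The variable \<open>t\<close> is the variable of the univariate polynomial type.\<close>

definition phi :: "nat \<Rightarrow> 'a::comm_ring_1 mat list \<Rightarrow> 'a vec \<Rightarrow> 'a poly" where
  "phi n As s = char_poly (W n As s)"

text \<open>
  Polynomials in the indeterminates \<open>s\<^sub>0, s\<^sub>1, \<dots>\<close>, as finitely supported maps from exponent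
  vectors (monomials) to coefficients, with the convolution product.
\<close>

type_synonym 'a mpoly = "(nat \<Rightarrow>\<^sub>0 nat) \<Rightarrow>\<^sub>0 'a"

definition mconst :: "'a::zero \<Rightarrow> 'a mpoly" where
  "mconst c = Poly_Mapping.single 0 c"

definition mvar :: "nat \<Rightarrow> 'a::zero_neq_one mpoly" where
  "mvar i = Poly_Mapping.single (Poly_Mapping.single i 1) 1"

text \<open>
  \<open>phi\<close> with indeterminate \<open>s\<close>: an element of \<open>\<real>[s\<^sub>0, \<dots>, s\<^sub>k\<^sub>-\<^sub>1][t]\<close>, so that equality of two
  such values is identity of polynomials in \<open>s\<close> and \<open>t\<close>.
\<close>

definition phi_poly :: "nat \<Rightarrow> real mat list \<Rightarrow> real mpoly poly" where
  "phi_poly n As = phi n (map (map_mat mconst) As) (vec (length As) mvar)"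

text \<open>
  The spectrum is the multiset of complex eigenvalues with algebraic multiplicity, in contrast to
  the constant \<open>spectrum\<close>, which is the set of eigenvalues.
\<close>

definition mspectrum :: "real mat \<Rightarrow> complex multiset" where
  "mspectrum M = proots (char_poly (map_mat complex_of_real M))"

end

theory Submission
  imports Defs
begin

text \<open>
  There are finitely many graphs, so only finitely many nonzero polynomials in \<open>s\<close> arise as
  coefficients of the differences of the polynomials \<open>phi_poly\<close>; any integer point at which none
  of them vanishes can serve as \<open>s\<^sub>0\<close>. Such a point exists by Kronecker's substitution
  \<open>s\<^sub>i = x ^ (D ^ i)\<close>: if \<open>D\<close> exceeds all exponents, distinct monomials become distinct powers of
  \<open>x\<close>, so each polynomial turns into a nonzero univariate one, and an integer \<open>x\<close> avoiding the
  finitely many roots remains to be chosen. The spectrum determines the characteristic polynomial,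
  as the latter is monic and splits over the complex numbers.
\<close>

section \<open>Evaluation of multivariate polynomials\<close>

definition monomial_eval :: "(nat \<Rightarrow> 'a) \<Rightarrow> (nat \<Rightarrow>\<^sub>0 nat) \<Rightarrow> 'a::comm_semiring_1" where
  "monomial_eval x m = (\<Prod>i\<in>Poly_Mapping.keys m. x i ^ Poly_Mapping.lookup m i)"

definition mpoly_eval :: "(nat \<Rightarrow> 'a) \<Rightarrow> 'a mpoly \<Rightarrow> 'a::comm_semiring_1" where
  "mpoly_eval x p = (\<Sum>m\<in>Poly_Mapping.keys p. Poly_Mapping.lookup p m * monomial_eval x m)"

text \<open>Indices outside the support contribute factors \<open>x i ^ 0 = 1\<close>. Monomials
  with different supports can thus be compared over one common index set.\<close>

lemma monomial_eval_superset:
  assumes "finite S" "Poly_Mapping.keys m \<subseteq> S"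
  shows "monomial_eval x m = (\<Prod>i\<in>S. x i ^ Poly_Mapping.lookup m i)"
  unfolding monomial_eval_def
  by (rule prod.mono_neutral_left) (use assms in \<open>auto simp: in_keys_iff\<close>)

lemma monomial_eval_0 [simp]: "monomial_eval x 0 = 1"
  by (simp add: monomial_eval_def)

lemma monomial_eval_add: "monomial_eval x (m + m') = monomial_eval x m * monomial_eval x m'"
proof -
  let ?S = "Poly_Mapping.keys m \<union> Poly_Mapping.keys m'"
  have "Poly_Mapping.keys (m + m') \<subseteq> ?S"
    by (rule keys_add)
  then show ?thesis
    by (simp add: monomial_eval_superset[of ?S] lookup_add power_add prod.distrib)
qed

lemma mpoly_eval_superset:
  assumes "finite S" "Poly_Mapping.keys p \<subseteq> S"
  shows "mpoly_eval x p = (\<Sum>m\<in>S. Poly_Mapping.lookup p m * monomial_eval x m)"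
  unfolding mpoly_eval_def
  by (rule sum.mono_neutral_left) (use assms in \<open>auto simp: in_keys_iff\<close>)

lemma mpoly_eval_0 [simp]: "mpoly_eval x 0 = 0"
  by (simp add: mpoly_eval_def)

lemma mpoly_eval_single [simp]:
  "mpoly_eval x (Poly_Mapping.single m c) = c * monomial_eval x m"
  by (simp add: mpoly_eval_superset[of "{m}"])

lemma mpoly_eval_mconst [simp]: "mpoly_eval x (mconst c) = c"
  by (simp add: mconst_def)

lemma mpoly_eval_mvar [simp]: "mpoly_eval x (mvar i) = x i"
  by (simp add: mvar_def monomial_eval_def)

lemma mpoly_eval_add: "mpoly_eval x (p + q) = mpoly_eval x p + mpoly_eval x q"
proof -
  let ?S = "Poly_Mapping.keys p \<union> Poly_Mapping.keys q"
  have "Poly_Mapping.keys (p + q) \<subseteq> ?S"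
    by (rule keys_add)
  then show ?thesis
    by (simp add: mpoly_eval_superset[of ?S] lookup_add distrib_right sum.distrib)
qed

lemma mpoly_eval_sum: "mpoly_eval x (\<Sum>a\<in>S. f a) = (\<Sum>a\<in>S. mpoly_eval x (f a))"
  by (induction S rule: infinite_finite_induct) (auto simp: mpoly_eval_add)

lemma poly_mapping_sum_single:
  "p = (\<Sum>m\<in>Poly_Mapping.keys p. Poly_Mapping.single m (Poly_Mapping.lookup p m))"
  by (rule poly_mapping_eqI) (auto simp: lookup_sum lookup_single when_def in_keys_iff)

lemma mpoly_eval_mult: "mpoly_eval x (p * q) = mpoly_eval x p * mpoly_eval x q"
proof -
  have "p * q = (\<Sum>m\<in>Poly_Mapping.keys p. \<Sum>m'\<in>Poly_Mapping.keys q.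
      Poly_Mapping.single (m + m') (Poly_Mapping.lookup p m * Poly_Mapping.lookup q m'))"
    \<comment> \<open>Splitting both factors into single terms makes the convolution explicit:
      exponent vectors add and coefficients multiply.\<close>
    by (subst poly_mapping_sum_single[of p], subst poly_mapping_sum_single[of q])
      (simp add: sum_product mult_single)
  then have "mpoly_eval x (p * q) = (\<Sum>m\<in>Poly_Mapping.keys p. \<Sum>m'\<in>Poly_Mapping.keys q.
      (Poly_Mapping.lookup p m * Poly_Mapping.lookup q m') * (monomial_eval x m * monomial_eval x m'))"
    by (simp add: mpoly_eval_sum monomial_eval_add)
  also have "\<dots> = mpoly_eval x p * mpoly_eval x q"
    by (simp add: mpoly_eval_def sum_product algebra_simps)
  finally show ?thesis .
qed

text \<open>As a ring homomorphism, evaluation commutes with determinants and hence with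
  characteristic polynomials.\<close>

lemma comm_ring_hom_mpoly_eval: "comm_ring_hom (mpoly_eval (x :: nat \<Rightarrow> 'a::comm_ring_1))"
proof
  show "mpoly_eval x 1 = 1"
    using mpoly_eval_single[of x 0 1] by (simp del: mpoly_eval_single)
qed (auto simp: mpoly_eval_add mpoly_eval_mult)

section \<open>Kronecker substitution\<close>

lemma base_expansion_unique:
  fixes f g :: "nat \<Rightarrow> nat"
  assumes "(\<Sum>i<N. f i * D ^ i) = (\<Sum>i<N. g i * D ^ i)"
    and "\<And>i. f i < D" "\<And>i. g i < D" "i < N"
  shows "f i = g i"
  using assms
proof (induction N arbitrary: f g i)
  case (Suc N)
  have split: "(\<Sum>i<Suc N. h i * D ^ i) = h 0 + D * (\<Sum>i<N. h (Suc i) * D ^ i)" for h :: "nat \<Rightarrow> nat"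
    by (simp only: sum.lessThan_Suc_shift) (simp add: sum_distrib_left algebra_simps)
  have eq: "f 0 + D * (\<Sum>i<N. f (Suc i) * D ^ i) = g 0 + D * (\<Sum>i<N. g (Suc i) * D ^ i)"
    using Suc.prems(1) unfolding split .
  have lt: "f 0 < D" "g 0 < D"
    using Suc.prems by auto
  \<comment> \<open>Reduction modulo \<open>D\<close> isolates the lowest digit; cancelling it and
    dividing by \<open>D > 0\<close> leaves the expansions shifted by one place.\<close>
  have "f 0 = g 0"
    using arg_cong[OF eq, of "\<lambda>k. k mod D"] lt by simp
  moreover have "(\<Sum>i<N. f (Suc i) * D ^ i) = (\<Sum>i<N. g (Suc i) * D ^ i)"
    using eq \<open>f 0 = g 0\<close> lt by simp
  ultimately show ?case
    using Suc.IH[of "\<lambda>i. f (Suc i)" "\<lambda>i. g (Suc i)" "i - 1"] Suc.prems(2-4)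
    by (cases i) simp_all
qed simp

text \<open>The exponent of \<open>x\<close> that the monomial \<open>m\<close> acquires under the
  substitution; the exponents in \<open>m\<close> are its base \<open>D\<close> digits as long as
  they stay below \<open>D\<close>.\<close>

definition kronecker_weight :: "nat \<Rightarrow> (nat \<Rightarrow>\<^sub>0 nat) \<Rightarrow> nat" where
  "kronecker_weight D m = (\<Sum>i\<in>Poly_Mapping.keys m. Poly_Mapping.lookup m i * D ^ i)"

lemma kronecker_weight_inj:
  assumes "kronecker_weight D m = kronecker_weight D m'"
    and "\<And>i. Poly_Mapping.lookup m i < D" "\<And>i. Poly_Mapping.lookup m' i < D"
  shows "m = m'"
proof -
  \<comment> \<open>Padding with zero digits up to a common length \<open>N\<close> brings both
    weights into the form required for comparing digits.\<close>
  obtain N where N: "Poly_Mapping.keys m \<union> Poly_Mapping.keys m' \<subseteq> {..<N}"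
    using finite_nat_iff_bounded[of "Poly_Mapping.keys m \<union> Poly_Mapping.keys m'"] by auto
  have weight: "kronecker_weight D l = (\<Sum>i<N. Poly_Mapping.lookup l i * D ^ i)" if "Poly_Mapping.keys l \<subseteq> {..<N}" for l
    unfolding kronecker_weight_def
    by (rule sum.mono_neutral_left) (use that in \<open>auto simp: in_keys_iff\<close>)
  have eq: "Poly_Mapping.lookup m i = Poly_Mapping.lookup m' i" if "i < N" for i
  proof (rule base_expansion_unique[OF _ assms(2,3) that])
    show "(\<Sum>i<N. Poly_Mapping.lookup m i * D ^ i) = (\<Sum>i<N. Poly_Mapping.lookup m' i * D ^ i)"
      using assms(1) N weight[of m] weight[of m'] by simp
  qed
  show ?thesis
  proof (rule poly_mapping_eqI)
    fix i
    show "Poly_Mapping.lookup m i = Poly_Mapping.lookup m' i"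
    proof (cases "i < N")
      case False
      then have "i \<notin> Poly_Mapping.keys m" "i \<notin> Poly_Mapping.keys m'"
        using N by auto
      then show ?thesis
        by (simp add: in_keys_iff)
    qed (rule eq)
  qed
qed

definition kronecker_poly :: "nat \<Rightarrow> 'a mpoly \<Rightarrow> 'a::comm_semiring_1 poly" where
  "kronecker_poly D p = (\<Sum>m\<in>Poly_Mapping.keys p. monom (Poly_Mapping.lookup p m) (kronecker_weight D m))"

lemma poly_kronecker_poly: "poly (kronecker_poly D p) x = mpoly_eval (\<lambda>i. x ^ (D ^ i)) p"
proof -
  have "x ^ kronecker_weight D m = monomial_eval (\<lambda>i. x ^ (D ^ i)) m" for m
    unfolding kronecker_weight_def monomial_eval_def power_sum
    by (intro prod.cong refl) (metis mult.commute power_mult)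
  then show ?thesis
    by (simp add: kronecker_poly_def mpoly_eval_def poly_sum poly_monom)
qed

text \<open>No two monomials of \<open>p\<close> share a weight, so nothing cancels: each
  coefficient of \<open>p\<close> survives at the weight of its monomial.\<close>

lemma kronecker_poly_nonzero:
  assumes "p \<noteq> 0" and bound: "\<And>m i. m \<in> Poly_Mapping.keys p \<Longrightarrow> Poly_Mapping.lookup m i < D"
  shows "kronecker_poly D p \<noteq> 0"
proof -
  obtain m where m: "m \<in> Poly_Mapping.keys p"
    using assms(1) by (metis all_not_in_conv keys_eq_empty)
  have "kronecker_weight D l = kronecker_weight D m \<longleftrightarrow> l = m" if "l \<in> Poly_Mapping.keys p" for l
    using kronecker_weight_inj[of D l m] bound that m by auto
  then have "coeff (kronecker_poly D p) (kronecker_weight D m) =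
      (\<Sum>l\<in>Poly_Mapping.keys p. if l = m then Poly_Mapping.lookup p l else 0)"
    by (auto simp: kronecker_poly_def coeff_sum coeff_monom intro!: sum.cong)
  also have "\<dots> = Poly_Mapping.lookup p m"
    using m by simp
  finally show ?thesis
    using m by (auto simp: in_keys_iff)
qed

lemma mpoly_common_nonroot:
  fixes P :: "'a::{idom, ring_char_0} mpoly set"
  assumes "finite P" "0 \<notin> P"
  obtains s :: "nat \<Rightarrow> int" where "\<And>p. p \<in> P \<Longrightarrow> mpoly_eval (\<lambda>i. of_int (s i)) p \<noteq> 0"
proof -
  \<comment> \<open>All exponents occurring in \<open>P\<close>, so that one \<open>D\<close> serves
    every polynomial. The added 0 forces \<open>D > 0\<close>, also bounding the exponents of absent
    variables.\<close>
  let ?E = "insert 0 (\<Union>p\<in>P. \<Union>m\<in>Poly_Mapping.keys p. Poly_Mapping.lookup m ` Poly_Mapping.keys m)"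
  have "finite ?E"
    using assms by auto
  then obtain D where D: "\<And>e. e \<in> ?E \<Longrightarrow> e < D"
    unfolding finite_nat_iff_bounded by blast
  have bound: "Poly_Mapping.lookup m i < D" if "p \<in> P" "m \<in> Poly_Mapping.keys p" for p m i
  proof (cases "i \<in> Poly_Mapping.keys m")
    case True
    then have "Poly_Mapping.lookup m i \<in> ?E"
      using that by blast
    then show ?thesis
      by (rule D)
  next
    case False
    then show ?thesis
      using D[of 0] by (simp add: in_keys_iff)
  qed
  have nz: "kronecker_poly D p \<noteq> 0" if "p \<in> P" for p
    using that assms(2) by (intro kronecker_poly_nonzero bound) auto
  let ?R = "\<Union>p\<in>P. {x. poly (kronecker_poly D p) x = 0}"
  have "finite ?R"
    using assms nz by (auto intro!: poly_roots_finite)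
  \<comment> \<open>In characteristic zero \<open>of_int\<close> is injective, so only finitely many
    integers map to roots.\<close>
  then have "finite ((of_int :: int \<Rightarrow> 'a) -` ?R)"
    by (rule finite_vimageI) (simp add: inj_def)
  then obtain x :: int where "x \<notin> of_int -` ?R"
    using ex_new_if_finite[OF infinite_UNIV_int] by blast
  then have "mpoly_eval (\<lambda>i. of_int (x ^ (D ^ i))) p \<noteq> 0" if "p \<in> P" for p
    using that by (auto simp: poly_kronecker_poly)
  then show thesis
    by (rule that)
qed

section \<open>Specialization of characteristic polynomials, and spectra\<close>

lemma W_carrier [simp]: "W n As s \<in> carrier_mat n n"
  by (simp add: W_def)

lemma (in comm_ring_hom) map_poly_phi:
  assumes "set As \<subseteq> carrier_mat n n" "length As \<le> dim_vec s"
  shows "map_poly hom (phi n As s) = phi n (map (map_mat hom) As) (map_vec hom s)"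
proof -
  have "As ! i \<in> carrier_mat n n" if "i < length As" for i
    using assms that by auto
  then have "map_mat hom (As ! i) $$ (p, q) = hom (As ! i $$ (p, q))"
    if "i < length As" "p < n" "q < n" for i p q
    using that by (metis carrier_matD index_map_mat(1))
  then have "map_mat hom (W n As s) = W n (map (map_mat hom) As) (map_vec hom s)"
    using assms(2) by (intro eq_matI) (auto simp: W_def hom_sum hom_mult)
  then show ?thesis
    unfolding phi_def using char_poly_hom[OF W_carrier, of n As s] by simp
qed

lemma map_poly_phi_poly:
  assumes "set As \<subseteq> carrier_mat n n"
  shows "map_poly (mpoly_eval x) (phi_poly n As) = phi n As (vec (length As) x)"
proof -
  interpret comm_ring_hom "mpoly_eval x"
    by (rule comm_ring_hom_mpoly_eval)
  have "map_vec (mpoly_eval x) (vec (length As) mvar) = vec (length As) x"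
    by (intro eq_vecI) auto
  moreover have "map (map_mat (mpoly_eval x)) (map (map_mat mconst) As) = As"
    by (auto intro!: map_idI eq_matI)
  ultimately show ?thesis
    unfolding phi_poly_def using assms by (subst map_poly_phi) auto
qed

lemma mspectrum_eq_iff:
  assumes "M \<in> carrier_mat n n" "N \<in> carrier_mat n n"
  shows "mspectrum M = mspectrum N \<longleftrightarrow> char_poly M = char_poly N"
proof
  let ?c = "\<lambda>M. char_poly (map_mat complex_of_real M)"
  \<comment> \<open>With leading coefficient 1, the factorization over the complex numbers has no
    scalar factor and depends on the roots alone.\<close>
  have monic: "lead_coeff (?c M) = 1" if "M \<in> carrier_mat n n" for M
    using degree_monic_char_poly[of "map_mat complex_of_real M" n] that by auto
  have decompose: "?c M = (\<Prod>x\<in>#mspectrum M. [:- x, 1:])" if "M \<in> carrier_mat n n" for M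
    using complex_poly_decompose_multiset[of "?c M"] monic[OF that] by (simp add: mspectrum_def)
  assume "mspectrum M = mspectrum N"
  then have "?c M = ?c N"
    using assms decompose by metis
  then have "map_poly complex_of_real (char_poly M) = map_poly complex_of_real (char_poly N)"
    using assms by (simp add: of_real_hom.char_poly_hom)
  \<comment> \<open>The embedding of the reals is injective, so coefficients can be compared before
    it is applied.\<close>
  then show "char_poly M = char_poly N"
    by (simp add: poly_eq_iff coeff_map_poly)
next
  assume "char_poly M = char_poly N"
  then show "mspectrum M = mspectrum N"
    using assms by (simp add: mspectrum_def of_real_hom.char_poly_hom)
qed

lemma finite_graphs: "finite (graphs n)"
proof (rule finite_subset)
  show "graphs n \<subseteq> {{1..n}} \<times> Pow (Pow {1..n})"
    by (auto simp: graphs_def)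
qed simp

theorem theorem5p4:
  fixes n k :: nat and A :: "graph \<Rightarrow> real mat list"
  assumes "n > 0" and "k > 0"
    and "\<And>G. G \<in> graphs n \<Longrightarrow> length (A G) = k \<and> set (A G) \<subseteq> carrier_mat n n"
  shows "\<exists>s\<^sub>0 :: int vec. s\<^sub>0 \<in> carrier_vec k \<and>
    (\<forall>G\<in>graphs n. \<forall>H\<in>graphs n.
      (phi_poly n (A G) = phi_poly n (A H) \<longleftrightarrow>
         phi n (A G) (map_vec real_of_int s\<^sub>0) = phi n (A H) (map_vec real_of_int s\<^sub>0)) \<and>
      (mspectrum (W n (A G) (map_vec real_of_int s\<^sub>0)) = mspectrum (W n (A H) (map_vec real_of_int s\<^sub>0)) \<longleftrightarrow>
         (\<forall>s\<in>carrier_vec k. mspectrum (W n (A G) s) = mspectrum (W n (A H) s))))"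
proof -
  \<comment> \<open>The coefficients with respect to \<open>t\<close> are polynomials in
    \<open>s\<close>. Removing 0 discards those that vanish identically, including all that come
    from \<open>G = H\<close>.\<close>
  define P where "P = (\<Union>G\<in>graphs n. \<Union>H\<in>graphs n.
    set (coeffs (phi_poly n (A G) - phi_poly n (A H)))) - {0}"
  have "finite P" "0 \<notin> P"
    by (auto simp: P_def finite_graphs)
  then obtain s :: "nat \<Rightarrow> int" where s: "\<And>p. p \<in> P \<Longrightarrow> mpoly_eval (\<lambda>i. of_int (s i)) p \<noteq> 0"
    using mpoly_common_nonroot by metis
  let ?s\<^sub>0 = "vec k s"
  let ?r = "map_vec real_of_int ?s\<^sub>0"
  have r: "?r = vec k (\<lambda>i. of_int (s i))"
    by (intro eq_vecI) auto
  have eval: "phi n (A G) (vec k x) = map_poly (mpoly_eval x) (phi_poly n (A G))"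
    if "G \<in> graphs n" for G x
    using map_poly_phi_poly[of "A G" n x] assms(3)[OF that] by simp
  \<comment> \<open>Only this direction uses the choice of \<open>s\<close>: a differing coefficient
    of \<open>t^j\<close> would give an element of \<open>P\<close> vanishing at the chosen
    point.\<close>
  have identity: "phi_poly n (A G) = phi_poly n (A H)"
    if G: "G \<in> graphs n" and H: "H \<in> graphs n" and eq: "phi n (A G) ?r = phi n (A H) ?r" for G H
  proof (rule ccontr)
    assume "phi_poly n (A G) \<noteq> phi_poly n (A H)"
    then obtain j where j: "coeff (phi_poly n (A G)) j \<noteq> coeff (phi_poly n (A H)) j"
      by (auto simp: poly_eq_iff)
    let ?d = "phi_poly n (A G) - phi_poly n (A H)"
    have "coeff ?d j \<noteq> 0"
      using j by simp
    then have "coeff ?d j \<in> P"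
      unfolding P_def using G H coeff_in_coeffs[of ?d j] by (fastforce intro: le_degree)
    interpret ev: comm_ring_hom "mpoly_eval (\<lambda>i. real_of_int (s i))"
      by (rule comm_ring_hom_mpoly_eval)
    have "mpoly_eval (\<lambda>i. real_of_int (s i)) (coeff ?d j) = 0"
      using arg_cong[OF eq[unfolded r eval[OF G] eval[OF H]], of "\<lambda>p. coeff p j"]
      by (simp add: coeff_map_poly ev.hom_minus)
    with \<open>coeff ?d j \<in> P\<close> show False
      using s by blast
  qed
  have all: "phi n (A G) t = phi n (A H) t"
    if "G \<in> graphs n" "H \<in> graphs n" "phi_poly n (A G) = phi_poly n (A H)" "t \<in> carrier_vec k"
    for G H t
  proof -
    have "t = vec k (($) t)"
      using that by (intro eq_vecI) auto
    then show ?thesis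
      using eval that by metis
  qed
  show ?thesis
  proof (intro exI[of _ ?s\<^sub>0] conjI ballI)
    fix G H
    assume G: "G \<in> graphs n" and H: "H \<in> graphs n"
    have r_carrier: "?r \<in> carrier_vec k"
      by simp
    show "phi_poly n (A G) = phi_poly n (A H) \<longleftrightarrow> phi n (A G) ?r = phi n (A H) ?r"
      using identity[OF G H] all[OF G H _ r_carrier] by blast
    have "mspectrum (W n (A G) t) = mspectrum (W n (A H) t) \<longleftrightarrow> phi n (A G) t = phi n (A H) t" for t
      unfolding phi_def by (rule mspectrum_eq_iff[OF W_carrier W_carrier])
    \<comment> \<open>Agreement at \<open>?r\<close> gives the polynomial identity, which
      specializes to every \<open>t\<close>; conversely \<open>?r\<close> is itself one of these
      \<open>t\<close>.\<close>
    then show "mspectrum (W n (A G) ?r) = mspectrum (W n (A H) ?r) \<longleftrightarrow>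
        (\<forall>t\<in>carrier_vec k. mspectrum (W n (A G) t) = mspectrum (W n (A H) t))"
      using identity[OF G H] all[OF G H] r_carrier by blast
  qed simp
qed

end
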